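(* If PA is consistent but not $\omega$-consistent, then the standard interpretation $\mathcal{I}_{PA(N,\ Standard)}$ of PA over $N$ is not sound, and does not yield a model of PA.
   Context: PA is first-order Peano Arithmetic over the symbols $0, {}', +, \star, =$, with standard first-order predicate calculus as underlying logic, axioms PA$_1$ $(x_1=x_2)\to((x_1=x_3)\to(x_2=x_3))$; PA$_2$ $(x_1=x_2)\to(x_1'=x_2')$; PA$_3$ $0\neq x_1'$; PA$_4$ $(x_1'=x_2')\to(x_1=x_2)$; PA$_5$ $x_1+0=x_1$; PA$_6$ $x_1+x_2'=(x_1+x_2)'$; PA$_7$ $x_1\star 0=0$; PA$_8$ $x_1\star x_2'=(x_1\star x_2)+x_1$; PA$_9$ (schema) $F(0)\to(((\forall x)(F(x)\to F(x')))\to(\forall x)F(x))$; and the rules Generalisation and Modus Ponens. Standard interpretation $\mathcal{I}_{PA(N,\ Standard)}$: the domain is the set $N$ of non-negative integers; $[0]$ interprets as $0$, $[']$ as successor, $[+]$ and $[\star]$ as ordinary addition and multiplication, $[=]$ as identity; the logical constants have their usual interpretations in Aristotle's logic of predicates, which subsumes Aristotle's particularisation. Satisfaction and truth are given by Tarski's usual inductive clauses. Aristotle's particularisation holds that from a meta-assertion `It is not the case that: for any given $x$, $P^*(x)$ does not hold' (denoted $\neg(\forall x)\neg P^*(x)$) we may always validly infer `There exists an unspecified $x$ such that $P^*(x)$ holds' (denoted $(\exists x)P^*(x)$). An interpretation $\mathcal{I}_S$ of a formal system $S$ over a domain $\mathbb{D}$ is sound iff every theorem $[T]$ of $S$ is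 true under $\mathcal{I}_S$ in $\mathbb{D}$; an interpretation is a model of $S$ iff it is sound. $S$ is (simply) consistent iff there is no $S$-formula $[F(x)]$ for which both $[(\forall x)F(x)]$ and $[\neg(\forall x)F(x)]$ are $S$-provable. $S$ is $\omega$-consistent iff there is no $S$-formula $[F(x)]$ for which, first, $[\neg(\forall x)F(x)]$ is $S$-provable and, second, $[F(a)]$ is $S$-provable for any given $S$-term $[a]$. *)

theory Defs
  imports Main
begin

datatype tm = Var nat | Zero | Succ tm | Add tm tm | Mul tm tm

datatype fm = Eq tm tm | Neg fm | Imp fm fm | All nat fm

abbreviation Exists :: "nat \<Rightarrow> fm \<Rightarrow> fm" where
  "Exists x F \<equiv> Neg (All x (Neg F))"

primrec vars_tm :: "tm \<Rightarrow> nat set" where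
  "vars_tm (Var x) = {x}"
| "vars_tm Zero = {}"
| "vars_tm (Succ s) = vars_tm s"
| "vars_tm (Add s t) = vars_tm s \<union> vars_tm t"
| "vars_tm (Mul s t) = vars_tm s \<union> vars_tm t"

primrec free_vars :: "fm \<Rightarrow> nat set" where
  "free_vars (Eq s t) = vars_tm s \<union> vars_tm t"
| "free_vars (Neg F) = free_vars F"
| "free_vars (Imp F G) = free_vars F \<union> free_vars G"
| "free_vars (All x F) = free_vars F - {x}"

primrec subst_tm :: "tm \<Rightarrow> nat \<Rightarrow> tm \<Rightarrow> tm" where
  "subst_tm (Var y) x a = (if y = x then a else Var y)"
| "subst_tm Zero x a = Zero"
| "subst_tm (Succ s) x a = Succ (subst_tm s x a)"
| "subst_tm (Add s t) x a = Add (subst_tm s x a) (subst_tm t x a)"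
| "subst_tm (Mul s t) x a = Mul (subst_tm s x a) (subst_tm t x a)"

text \<open>\<open>subst F x a\<close> replaces the free occurrences of the variable \<open>x\<close> in \<open>F\<close> by \<open>a\<close> without
  renaming bound variables; wherever capture could occur, \<open>free_for\<close> is required separately.\<close>

primrec subst :: "fm \<Rightarrow> nat \<Rightarrow> tm \<Rightarrow> fm" where
  "subst (Eq s t) x a = Eq (subst_tm s x a) (subst_tm t x a)"
| "subst (Neg F) x a = Neg (subst F x a)"
| "subst (Imp F G) x a = Imp (subst F x a) (subst G x a)"
| "subst (All y F) x a = (if y = x then All y F else All y (subst F x a))"

primrec free_for :: "tm \<Rightarrow> nat \<Rightarrow> fm \<Rightarrow> bool" where
  "free_for a x (Eq s t) \<longleftrightarrow> True"
| "free_for a x (Neg F) \<longleftrightarrow> free_for a x F"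
| "free_for a x (Imp F G) \<longleftrightarrow> free_for a x F \<and> free_for a x G"
| "free_for a x (All y F) \<longleftrightarrow>
     x \<notin> free_vars (All y F) \<or> (y \<notin> vars_tm a \<and> free_for a x F)"

text \<open>A formal system in this language is given by its set of proper axioms. The underlying logic
  is the usual Hilbert-style predicate calculus with the rules Modus Ponens and Generalisation
  (as in Mendelson); equality is a non-logical symbol.\<close>

inductive provable :: "fm set \<Rightarrow> fm \<Rightarrow> bool" (infix "\<turnstile>" 55) for S :: "fm set" where
  axiom: "F \<in> S \<Longrightarrow> S \<turnstile> F"
| L1: "S \<turnstile> Imp F (Imp G F)"
| L2: "S \<turnstile> Imp (Imp F (Imp G H)) (Imp (Imp F G) (Imp F H))"
| L3: "S \<turnstile> Imp (Imp (Neg G) (Neg F)) (Imp (Imp (Neg G) F) G)"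
| L4: "free_for a x F \<Longrightarrow> S \<turnstile> Imp (All x F) (subst F x a)"
| L5: "x \<notin> free_vars F \<Longrightarrow> S \<turnstile> Imp (All x (Imp F G)) (Imp F (All x G))"
| MP: "S \<turnstile> F \<Longrightarrow> S \<turnstile> Imp F G \<Longrightarrow> S \<turnstile> G"
| Gen: "S \<turnstile> F \<Longrightarrow> S \<turnstile> All x F"

text \<open>In the induction schema no capture can occur: \<open>Zero\<close> has no variables, and \<open>Succ (Var x)\<close>
  contains only \<open>x\<close> itself, which is not bound at a free occurrence of \<open>x\<close>.\<close>

definition PA :: "fm set" where
  "PA =
    { Imp (Eq (Var 1) (Var 2)) (Imp (Eq (Var 1) (Var 3)) (Eq (Var 2) (Var 3))),
      Imp (Eq (Var 1) (Var 2)) (Eq (Succ (Var 1)) (Succ (Var 2))),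
      Neg (Eq Zero (Succ (Var 1))),
      Imp (Eq (Succ (Var 1)) (Succ (Var 2))) (Eq (Var 1) (Var 2)),
      Eq (Add (Var 1) Zero) (Var 1),
      Eq (Add (Var 1) (Succ (Var 2))) (Succ (Add (Var 1) (Var 2))),
      Eq (Mul (Var 1) Zero) Zero,
      Eq (Mul (Var 1) (Succ (Var 2))) (Add (Mul (Var 1) (Var 2)) (Var 1)) }
    \<union> { Imp (subst F x Zero)
           (Imp (All x (Imp F (subst F x (Succ (Var x))))) (All x F)) | F x. True }"

definition consistent :: "fm set \<Rightarrow> bool" where
  "consistent S \<longleftrightarrow> \<not> (\<exists>F x. S \<turnstile> All x F \<and> S \<turnstile> Neg (All x F))"

text \<open>The terms \<open>a\<close> in \<open>F(a)\<close> range over the closed terms (the names of individuals). If variables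
  were admitted, the instance \<open>a = x\<close> would be \<open>F(x)\<close> itself, Generalisation would yield
  \<open>(\<forall>x)F(x)\<close> (see \<open>provable_All_of_all_terms\<close>), and the notion would collapse to simple
  consistency.\<close>

definition omega_consistent :: "fm set \<Rightarrow> bool" where
  "omega_consistent S \<longleftrightarrow>
     \<not> (\<exists>F x. S \<turnstile> Neg (All x F) \<and> (\<forall>a. vars_tm a = {} \<longrightarrow> S \<turnstile> subst F x a))"

lemma subst_tm_Var [simp]: "subst_tm t x (Var x) = t"
  by (induction t) auto

lemma subst_Var [simp]: "subst F x (Var x) = F"
  by (induction F) auto

lemma provable_All_of_all_terms: "(\<And>a. S \<turnstile> subst F x a) \<Longrightarrow> S \<turnstile> All x F"
  by (metis Gen subst_Var)

text \<open>The domain of an interpretation is the whole (nonempty) type \<open>'a\<close>.\<close>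

record 'a interp =
  zeroI :: 'a
  succI :: "'a \<Rightarrow> 'a"
  addI :: "'a \<Rightarrow> 'a \<Rightarrow> 'a"
  mulI :: "'a \<Rightarrow> 'a \<Rightarrow> 'a"
  eqI :: "'a \<Rightarrow> 'a \<Rightarrow> bool"

primrec val :: "'a interp \<Rightarrow> (nat \<Rightarrow> 'a) \<Rightarrow> tm \<Rightarrow> 'a" where
  "val I v (Var x) = v x"
| "val I v Zero = zeroI I"
| "val I v (Succ s) = succI I (val I v s)"
| "val I v (Add s t) = addI I (val I v s) (val I v t)"
| "val I v (Mul s t) = mulI I (val I v s) (val I v t)"

primrec sat :: "'a interp \<Rightarrow> (nat \<Rightarrow> 'a) \<Rightarrow> fm \<Rightarrow> bool" where
  "sat I v (Eq s t) \<longleftrightarrow> eqI I (val I v s) (val I v t)"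
| "sat I v (Neg F) \<longleftrightarrow> \<not> sat I v F"
| "sat I v (Imp F G) \<longleftrightarrow> (sat I v F \<longrightarrow> sat I v G)"
| "sat I v (All x F) \<longleftrightarrow> (\<forall>d. sat I (v(x := d)) F)"

text \<open>Aristotle's particularisation holds under every interpretation in this sense.\<close>

lemma sat_Exists: "sat I v (Exists x F) \<longleftrightarrow> (\<exists>d. sat I (v(x := d)) F)"
  by simp

definition true_in :: "'a interp \<Rightarrow> fm \<Rightarrow> bool" where
  "true_in I F \<longleftrightarrow> (\<forall>v. sat I v F)"

definition sound :: "'a interp \<Rightarrow> fm set \<Rightarrow> bool" where
  "sound I S \<longleftrightarrow> (\<forall>F. S \<turnstile> F \<longrightarrow> true_in I F)"

definition model_of :: "'a interp \<Rightarrow> fm set \<Rightarrow> bool" where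
  "model_of I S \<longleftrightarrow> sound I S"

definition standard_interp :: "nat interp" where
  "standard_interp = \<lparr>zeroI = 0, succI = Suc, addI = (+), mulI = (*), eqI = (=)\<rparr>"

end

theory Submission
  imports Defs
begin

text \<open>If every element of the domain is denoted by a closed term, then the truth of all closed
  instances of \<open>F(x)\<close> forces the truth of \<open>(\<forall>x)F(x)\<close>, so a sound interpretation of this kind
  refutes any \<open>\<omega>\<close>-inconsistency. Over the natural numbers the numerals denote everything.\<close>

lemma val_cong: "(\<And>x. x \<in> vars_tm t \<Longrightarrow> v x = w x) \<Longrightarrow> val I v t = val I w t"
  by (induction t) auto

lemma val_closed: "vars_tm t = {} \<Longrightarrow> val I v t = val I w t"
  by (rule val_cong) simp

lemma val_subst_tm: "val I v (subst_tm t x a) = val I (v(x := val I v a)) t"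
  by (induction t) auto

text \<open>Closedness of \<open>a\<close> rules out capture: updating the valuation at a bound
  variable leaves the value of \<open>a\<close> unchanged.\<close>

lemma sat_subst_closed:
  assumes "vars_tm a = {}"
  shows "sat I v (subst F x a) \<longleftrightarrow> sat I (v(x := val I v a)) F"
proof (induction F arbitrary: v)
  case (All y F)
  have "val I (v(y := d)) a = val I v a" for d
    using assms by (rule val_closed)
  with All show ?case
    by (cases "y = x") (simp_all only: subst.simps sat.simps fun_upd_upd fun_upd_twist if_True if_False simp_thms)
qed (simp_all add: val_subst_tm)

lemma sound_imp_omega_consistent:
  assumes "sound I S"
    and named: "\<And>d. \<exists>a. vars_tm a = {} \<and> (\<forall>v. val I v a = d)"
  shows "omega_consistent S"
  unfolding omega_consistent_def
proof clarify
  fix F x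
  assume neg: "S \<turnstile> Neg (All x F)" and inst: "\<forall>a. vars_tm a = {} \<longrightarrow> S \<turnstile> subst F x a"
  have "sat I (v(x := d)) F" for v d
  proof -
    \<comment> \<open>A closed name \<open>a\<close> of \<open>d\<close> makes this an instance
      \<open>subst F x a\<close>, which is provable and hence true.\<close>
    obtain a where "vars_tm a = {}" "val I v a = d"
      using named by blast
    with inst \<open>sound I S\<close> show ?thesis
      by (metis sat_subst_closed sound_def true_in_def)
  qed
  with neg \<open>sound I S\<close> show False
    by (auto simp: sound_def true_in_def)
qed

primrec numeral_tm :: "nat \<Rightarrow> tm" where
  "numeral_tm 0 = Zero"
| "numeral_tm (Suc n) = Succ (numeral_tm n)"

lemma vars_numeral_tm [simp]: "vars_tm (numeral_tm n) = {}"
  by (induction n) auto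

text \<open>Discharges \<open>named\<close> for the standard interpretation, with
  \<open>numeral_tm d\<close> as the closed term denoting \<open>d\<close>.\<close>

lemma val_numeral_tm [simp]: "val standard_interp v (numeral_tm n) = n"
  by (induction n) (auto simp: standard_interp_def)

theorem corollary10:
  assumes "consistent PA"
    and "\<not> omega_consistent PA"
  shows "\<not> sound standard_interp PA \<and> \<not> model_of standard_interp PA"
proof -
  have "\<not> sound standard_interp PA"
    using assms(2) sound_imp_omega_consistent vars_numeral_tm val_numeral_tm by metis
  then show ?thesis
    by (simp add: model_of_def)
qed

end
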